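(* For all integers $n, m > 1$, we have $$S(n,m) = n + m - \gcd(n,m).$$
   Context: For positive integers $n,m$, an $n\times m$ real array $A=(a_{i,j})$ with all $a_{i,j}\ge 0$ is called doubly stochastic (with uniform marginals) if $\sum_{i=1}^n a_{i,j}=n$ for every column $j=1,\dots,m$ and $\sum_{j=1}^m a_{i,j}=m$ for every row $i=1,\dots,n$. The set of all such arrays is denoted $\mathcal{M}(n,m)$. The support $\operatorname{supp} A$ is the set of positions $(i,j)$ with $a_{i,j}\neq 0$, and $|\operatorname{supp} A|$ is its cardinality. Define $S(n,m)=\min\{|\operatorname{supp} A| : A\in\mathcal{M}(n,m)\}$. *)

theory Defs
  imports Complex_Main "Jordan_Normal_Form.Matrix"
begin

(* Matrix indices are 0-based: rows are i < n and columns are j < m. *)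

definition doubly_stochastic_arrays :: "nat \<Rightarrow> nat \<Rightarrow> real mat set" where
  "doubly_stochastic_arrays n m =
     {A \<in> carrier_mat n m.
        (\<forall>i<n. \<forall>j<m. A $$ (i, j) \<ge> 0) \<and>
        (\<forall>j<m. (\<Sum>i<n. A $$ (i, j)) = real n) \<and>
        (\<forall>i<n. (\<Sum>j<m. A $$ (i, j)) = real m)}"

definition supp_mat :: "real mat \<Rightarrow> (nat \<times> nat) set" where
  "supp_mat A = {(i, j). i < dim_row A \<and> j < dim_col A \<and> A $$ (i, j) \<noteq> 0}"

(* For n, m > 0 this is the minimum of a finite nonempty set: the all-ones array is
   doubly stochastic, and every support has at most n * m elements. *)
definition min_support :: "nat \<Rightarrow> nat \<Rightarrow> nat" where
  "min_support n m = Min ((\<lambda>A. card (supp_mat A)) ` doubly_stochastic_arrays n m)"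

end

theory Submission
  imports Defs
begin

text \<open>
  View the support of an array as the edge set of a bipartite graph on the \<open>n\<close> rows and the
  \<open>m\<close> columns.

  For the lower bound, a graph with \<open>n + m\<close> vertices and \<open>e\<close> edges has at least \<open>n + m - e\<close>
  components (\<open>bipartite_labelling\<close>).  Within a component with \<open>r\<close> rows and \<open>c\<close> columns, the
  total mass can be summed by rows or by columns, so \<open>r * m = c * n\<close>.  Hence \<open>r\<close> is a positive
  multiple of \<open>n div gcd n m\<close>, and as the row counts add up to \<open>n\<close> there can be no more than
  \<open>gcd n m\<close> components (\<open>card_support_lower_bound\<close>).

  For the upper bound, cut the interval of length \<open>n * m\<close> once into \<open>n\<close> pieces of length \<open>m\<close>
  and once into \<open>m\<close> pieces of length \<open>n\<close>, and let the entry \<open>(i, j)\<close> be the length of the overlap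
  of the \<open>i\<close>-th piece of the first kind with the \<open>j\<close>-th piece of the second kind.  Nonempty
  overlaps correspond to the left end points of the common refinement, that is, to the
  multiples of \<open>m\<close> or \<open>n\<close> below \<open>n * m\<close>.  Of these there are \<open>n + m - gcd n m\<close>, because the
  multiples counted twice are those of \<open>lcm n m\<close> (\<open>card_multiples_of_either\<close>).
\<close>

section \<open>Components of the support graph\<close>

text \<open>
  The labels stand for unions of connected components.  Connectedness of the label classes is
  never asserted: a labelling that is constant along edges and has many values is all that the
  mass count below asks for, and it can be built by adding the edges one at a time, each of
  which merges at most two classes.
\<close>

lemma bipartite_labelling:
  fixes R :: "'a set" and C :: "'b set"
  assumes "finite E" "finite R" "finite C"
  shows "\<exists>f :: 'a + 'b \<Rightarrow> 'a + 'b. (\<forall>(i, j)\<in>E. f (Inl i) = f (Inr j)) \<and>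
           card R + card C \<le> card E + card (f ` (R <+> C))"
  using assms(1)
proof (induction E rule: finite_induct)
  case empty
  show ?case
    using assms by (intro exI[of _ id]) (simp add: card_Plus)
next
  case (insert e E)
  obtain a b where e: "e = (a, b)"
    by (cases e)
  obtain f :: "'a + 'b \<Rightarrow> 'a + 'b" where f: "\<forall>(i, j)\<in>E. f (Inl i) = f (Inr j)"
    and card_f: "card R + card C \<le> card E + card (f ` (R <+> C))"
    using insert.IH by blast
  define g where "g x = (if f x = f (Inl a) then f (Inr b) else f x)" for x
  have fin: "finite (R <+> C)"
    using assms by simp
  have "f ` (R <+> C) \<subseteq> insert (f (Inl a)) (g ` (R <+> C))"
    by (force simp: g_def)
  then have "card (f ` (R <+> C)) \<le> card (insert (f (Inl a)) (g ` (R <+> C)))"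
    using fin by (intro card_mono) auto
  also have "\<dots> \<le> Suc (card (g ` (R <+> C)))"
    by (rule card_insert_le_m1) simp_all
  finally have "card R + card C \<le> card (insert e E) + card (g ` (R <+> C))"
    using card_f insert.hyps by simp
  moreover have "\<forall>(i, j)\<in>insert e E. g (Inl i) = g (Inr j)"
    using f by (auto simp: g_def e)
  ultimately show ?case
    by blast
qed

lemma finite_supp_mat: "finite (supp_mat A)"
  by (rule finite_subset[of _ "{..<dim_row A} \<times> {..<dim_col A}"]) (auto simp: supp_mat_def)

lemma card_supp_mat_le: "card (supp_mat A) \<le> dim_row A * dim_col A"
proof -
  have "card (supp_mat A) \<le> card ({..<dim_row A} \<times> {..<dim_col A})"
    by (rule card_mono) (auto simp: supp_mat_def)
  then show ?thesis
    by (simp add: card_cartesian_product)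
qed

text \<open>
  Both sides are the mass of the block \<open>R \<times> C\<close>: a row of \<open>R\<close> has all its mass in the columns
  of \<open>C\<close>, and a column of \<open>C\<close> has all its mass in the rows of \<open>R\<close>.
\<close>

lemma closed_block_mass:
  assumes A: "A \<in> doubly_stochastic_arrays n m"
    and sub: "R \<subseteq> {..<n}" "C \<subseteq> {..<m}"
    and closed: "\<And>i j. (i, j) \<in> supp_mat A \<Longrightarrow> i \<in> R \<longleftrightarrow> j \<in> C"
  shows "card R * m = card C * n"
proof -
  have dims: "dim_row A = n" "dim_col A = m"
    and cols: "\<And>j. j < m \<Longrightarrow> (\<Sum>i<n. A $$ (i, j)) = real n"
    and rows: "\<And>i. i < n \<Longrightarrow> (\<Sum>j<m. A $$ (i, j)) = real m"
    using A by (auto simp: doubly_stochastic_arrays_def)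
  have zero: "A $$ (i, j) = 0" if "i < n" "j < m" "i \<in> R \<longleftrightarrow> j \<notin> C" for i j
    using closed[of i j] that by (auto simp: supp_mat_def dims)
  have "real (card R * m) = (\<Sum>i\<in>R. \<Sum>j<m. A $$ (i, j))"
    using sub rows by (simp add: subset_eq)
  also have "\<dots> = (\<Sum>i\<in>R. \<Sum>j\<in>C. A $$ (i, j))"
    using sub zero by (intro sum.cong refl sum.mono_neutral_right) auto
  also have "\<dots> = (\<Sum>j\<in>C. \<Sum>i\<in>R. A $$ (i, j))"
    by (rule sum.swap)
  also have "\<dots> = (\<Sum>j\<in>C. \<Sum>i<n. A $$ (i, j))"
    using sub zero by (intro sum.cong refl sum.mono_neutral_left) auto
  also have "\<dots> = real (card C * n)"
    using sub cols by (simp add: subset_eq)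
  finally show ?thesis
    using of_nat_eq_iff by blast
qed

lemma div_gcd_dvd_if_mult_eq:
  fixes r c n m :: nat
  assumes "n > 0" and "r * m = c * n"
  shows "n div gcd n m dvd r"
proof -
  define g where "g = gcd n m"
  have "g > 0" and n: "n = g * (n div g)" and m: "m = g * (m div g)"
    using assms by (simp_all add: g_def)
  have "g * (r * (m div g)) = g * (c * (n div g))"
    using assms(2) n m by (metis mult.left_commute)
  then have "r * (m div g) = c * (n div g)"
    using \<open>g > 0\<close> by simp
  then have "n div g dvd r * (m div g)"
    by simp
  moreover have "coprime (n div g) (m div g)"
    unfolding g_def using assms by (intro div_gcd_coprime) simp
  ultimately show ?thesis
    by (simp add: coprime_dvd_mult_left_iff g_def)
qed

lemma card_support_lower_bound:
  assumes A: "A \<in> doubly_stochastic_arrays n m" and "n > 0" "m > 0"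
  shows "n + m \<le> card (supp_mat A) + gcd n m"
proof -
  obtain f :: "nat + nat \<Rightarrow> nat + nat"
    where f: "\<forall>(i, j)\<in>supp_mat A. f (Inl i) = f (Inr j)"
      and le: "n + m \<le> card (supp_mat A) + card (f ` ({..<n} <+> {..<m}))"
    using bipartite_labelling[of "supp_mat A" "{..<n}" "{..<m}"] finite_supp_mat by auto
  define K where "K = f ` ({..<n} <+> {..<m})"
  define R where "R k = {i\<in>{..<n}. f (Inl i) = k}" for k
  define C where "C k = {j\<in>{..<m}. f (Inr j) = k}" for k
  define q where "q = n div gcd n m"
  have fin: "finite K" "finite (R k)" "finite (C k)" for k
    by (simp_all add: K_def R_def C_def)
  have dims: "dim_row A = n" "dim_col A = m"
    using A by (auto simp: doubly_stochastic_arrays_def)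
  have "q \<le> card (R k)" if "k \<in> K" for k
  proof -
    have mass: "card (R k) * m = card (C k) * n"
      by (rule closed_block_mass[OF A])
         (use f in \<open>auto simp: R_def C_def supp_mat_def dims\<close>)
    have "R k \<noteq> {} \<or> C k \<noteq> {}"
      using that by (auto simp: K_def R_def C_def)
    \<comment> \<open>A class of columns alone would carry the mass of those columns without any row.\<close>
    then have "card (R k) > 0"
      using mass fin assms(2,3) by (metis card_gt_0_iff mult_eq_0_iff neq0_conv)
    then show ?thesis
      using div_gcd_dvd_if_mult_eq[OF assms(2) mass] by (simp add: q_def dvd_imp_le)
  qed
  then have "card K * q \<le> (\<Sum>k\<in>K. card (R k))"
    using sum_bounded_below[of K q "\<lambda>k. card (R k)"] by simp
  also have "\<dots> = card (\<Union>k\<in>K. R k)"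
    by (rule card_UN_disjoint[symmetric]) (use fin in \<open>auto simp: R_def\<close>)
  also have "(\<Union>k\<in>K. R k) = {..<n}"
    by (auto simp: R_def K_def)
  also have "card {..<n} = gcd n m * q"
    by (simp add: q_def)
  finally have "card K * q \<le> gcd n m * q" .
  moreover have "q > 0"
    using assms by (simp add: q_def div_greater_zero_iff dvd_imp_le)
  ultimately have "card K \<le> gcd n m"
    by simp
  then show ?thesis
    using le by (simp add: K_def)
qed

section \<open>The overlap array of two subdivisions\<close>

text \<open>Lengths of intervals with integer end points are measured by counting the integers in them.\<close>

definition overlap_array :: "nat \<Rightarrow> nat \<Rightarrow> real mat" where
  "overlap_array n m = mat n m (\<lambda>(i, j). real (card {t\<in>{..<n * m}. t div m = i \<and> t div n = j}))"

lemma card_div_eq: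
  fixes d k i :: nat
  assumes "i < k"
  shows "card {t\<in>{..<k * d}. t div d = i} = d"
proof (cases "d = 0")
  case False
  have "t < k * d" if "t div d = i" for t
    using that assms False by (simp add: div_less_iff_less_mult[symmetric])
  then have "{t\<in>{..<k * d}. t div d = i} = {i * d..<i * d + d}"
    using False by (auto simp: div_nat_eqI div_times_less_eq_dividend dividend_less_times_div
        mult.commute add.commute)
  then show ?thesis
    by simp
qed simp

lemma card_eq_sum_fibres:
  assumes "finite S" "finite K" "h ` S \<subseteq> K"
  shows "card S = (\<Sum>k\<in>K. card {t\<in>S. h t = k})"
  using sum.group[OF assms, of "\<lambda>_. 1 :: nat"] by simp

lemma overlap_array_doubly_stochastic:
  "overlap_array n m \<in> doubly_stochastic_arrays n m"
proof -
  have "(\<Sum>i<n. overlap_array n m $$ (i, j)) = real n" if "j < m" for j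
  proof -
    let ?S = "{t\<in>{..<n * m}. t div n = j}"
    have "card ?S = n"
      using card_div_eq[OF that, of n] by (simp add: mult.commute)
    moreover have "card ?S = (\<Sum>i<n. card {t\<in>?S. t div m = i})"
      by (rule card_eq_sum_fibres) (auto simp: less_mult_imp_div_less)
    moreover have "{t\<in>?S. t div m = i} = {t\<in>{..<n * m}. t div m = i \<and> t div n = j}" for i
      by auto
    ultimately show ?thesis
      using that by (simp add: overlap_array_def flip: of_nat_sum)
  qed
  moreover have "(\<Sum>j<m. overlap_array n m $$ (i, j)) = real m" if "i < n" for i
  proof -
    let ?S = "{t\<in>{..<n * m}. t div m = i}"
    have "card ?S = m"
      using card_div_eq[OF that, of m] .
    moreover have "card ?S = (\<Sum>j<m. card {t\<in>?S. t div n = j})"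
      by (rule card_eq_sum_fibres) (auto simp: less_mult_imp_div_less mult.commute)
    moreover have "{t\<in>?S. t div n = j} = {t\<in>{..<n * m}. t div m = i \<and> t div n = j}" for j
      by auto
    ultimately show ?thesis
      using that by (simp add: overlap_array_def flip: of_nat_sum)
  qed
  ultimately show ?thesis
    by (simp add: doubly_stochastic_arrays_def overlap_array_def)
qed

lemma card_multiples_below:
  fixes d k :: nat
  assumes "d > 0"
  shows "card {t\<in>{..<d * k}. d dvd t} = k"
proof -
  have "{t\<in>{..<d * k}. d dvd t} = (*) d ` {..<k}"
    using assms by (auto elim!: dvdE)
  then show ?thesis
    using assms by (simp add: card_image inj_on_def)
qed

lemma card_multiples_of_either:
  fixes n m :: nat
  assumes "n > 0" "m > 0"
  shows "card {t\<in>{..<n * m}. m dvd t \<or> n dvd t} = n + m - gcd n m"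
proof -
  let ?M = "\<lambda>d. {t\<in>{..<n * m}. d dvd t}"
  have "card (?M m) = n" "card (?M n) = m"
    using card_multiples_below[of m n] card_multiples_below[of n m] assms
    by (simp_all add: mult.commute)
  moreover have "card (?M (lcm n m)) = gcd n m"
    using card_multiples_below[of "lcm n m" "gcd n m"] assms
    by (metis lcm_pos_nat mult.commute prod_gcd_lcm_nat)
  moreover have "?M m \<inter> ?M n = ?M (lcm n m)"
    by auto
  moreover have "{t\<in>{..<n * m}. m dvd t \<or> n dvd t} = ?M m \<union> ?M n"
    by auto
  ultimately show ?thesis
    using card_Un_Int[of "?M m" "?M n"] by simp
qed

text \<open>
  Moving a point \<open>s\<close> left to the nearest multiple of \<open>m\<close> or of \<open>n\<close>, whichever comes first, leaves
  neither of the two pieces that contain it.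
\<close>

lemma card_support_overlap_array:
  assumes "n > 0" "m > 0"
  shows "card (supp_mat (overlap_array n m)) \<le> n + m - gcd n m"
proof -
  let ?T = "{t\<in>{..<n * m}. m dvd t \<or> n dvd t}"
  have "supp_mat (overlap_array n m) \<subseteq> (\<lambda>t. (t div m, t div n)) ` ?T"
  proof (rule subrelI)
    fix i j
    assume "(i, j) \<in> supp_mat (overlap_array n m)"
    then have "{t\<in>{..<n * m}. t div m = i \<and> t div n = j} \<noteq> {}"
      by (auto simp: supp_mat_def overlap_array_def)
    then obtain s where s: "s < n * m" "s div m = i" "s div n = j"
      by auto
    define t where "t = max (m * (s div m)) (n * (s div n))"
    have "t \<le> s"
      by (simp add: t_def)
    have "t div d = s div d" if "d * (s div d) \<le> t" "d > 0" for d
    proof (rule antisym)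
      show "t div d \<le> s div d"
        using \<open>t \<le> s\<close> by (rule div_le_mono)
      show "s div d \<le> t div d"
        using div_le_mono[OF that(1), of d] that(2) by simp
    qed
    then have "t div m = i" "t div n = j"
      using assms s by (simp_all add: t_def)
    moreover have "t \<in> ?T"
      using \<open>t \<le> s\<close> s(1) by (auto simp: t_def max_def)
    ultimately show "(i, j) \<in> (\<lambda>t. (t div m, t div n)) ` ?T"
      by blast
  qed
  then have "card (supp_mat (overlap_array n m)) \<le> card ?T"
    by (rule surj_card_le[rotated]) simp
  then show ?thesis
    using card_multiples_of_either[OF assms] by simp
qed

section \<open>The minimum support size\<close>

theorem theorem1:
  fixes n m :: nat
  assumes "n > 1" and "m > 1"
  shows "min_support n m = n + m - gcd n m"
proof -
  let ?sizes = "(\<lambda>A. card (supp_mat A)) ` doubly_stochastic_arrays n m"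
  have lower: "n + m - gcd n m \<le> card (supp_mat A)" if "A \<in> doubly_stochastic_arrays n m" for A
    using card_support_lower_bound[OF that] assms by simp
  have "card (supp_mat (overlap_array n m)) = n + m - gcd n m"
    using card_support_overlap_array[of n m] lower[OF overlap_array_doubly_stochastic] assms
    by simp
  then have "n + m - gcd n m \<in> ?sizes"
    using overlap_array_doubly_stochastic by (metis imageI)
  moreover have "?sizes \<subseteq> {..n * m}"
  proof clarsimp
    fix A
    assume "A \<in> doubly_stochastic_arrays n m"
    then show "card (supp_mat A) \<le> n * m"
      using card_supp_mat_le[of A] by (auto simp: doubly_stochastic_arrays_def)
  qed
  then have "finite ?sizes"
    by (rule finite_subset) simp
  ultimately show ?thesis
    unfolding min_support_def using lower by (intro Min_eqI) auto
qed

end
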